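(* Let $A$ be a square complex matrix (for instance the adjacency matrix of a graph), let $\Sigma$ be a complex matrix with orthonormal columns and as many rows as $A$, and let $U(t,A):=e^{-itA}$ be the quantum walk matrix of $A$ in terms of the variable $t$. Then $$\Sigma^*U(t,A)\Sigma=\mathscr{L}^{-1}_{t\to s}\left(\left(sI+i\,\mathcal{R}(is,\Sigma,A)\right)^{-1}\right)$$ and $$\mathcal{R}(\lambda,\Sigma,A)=\lambda I-i\left(\mathscr{L}_{t\to -i\lambda}\left(\Sigma^*U(t,A)\Sigma\right)\right)^{-1}.$$
   Context: The generalized isospectral reduction of $A$ with respect to $\Sigma$ is $\mathcal{R}(\lambda,\Sigma,A)=\lambda I-\left(\Sigma^*(\lambda I-A)^{-1}\Sigma\right)^{-1}$, a matrix of rational functions in $\lambda$; $\mathcal{R}(is,\Sigma,A)$ is obtained by substituting $\lambda=is$. $\mathscr{L}_{t\to s}$ denotes the Laplace transform $\mathscr{L}_{t\to s}f(t)=\int_0^\infty f(t)e^{-st}\,dt$, applied entrywise to matrix-valued functions (defined for $\operatorname{Re}s$ sufficiently large and identified with the resulting rational function of $s$); $\mathscr{L}^{-1}_{t\to s}$ denotes its inverse, sending functions of $s$ to functions of $t$; and $\mathscr{L}_{t\to -i\lambda}$ is the Laplace transform with $s=-i\lambda$. $\Sigma^*$ is the conjugate transpose. *)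

theory Defs
  imports
    "HOL-Analysis.Analysis"
    "HOL-Computational_Algebra.Computational_Algebra"
    "HOL-Computational_Algebra.Field_as_Ring"
begin

section \<open>Complex matrices\<close>

definition mat_scale :: "'a::times \<Rightarrow> 'a^'n^'m \<Rightarrow> 'a^'n^'m"  (infixl "*\<^sub>m" 75)
  where "c *\<^sub>m M = (\<chi> i j. c * M $ i $ j)"

definition conj_transpose :: "complex^'m^'n \<Rightarrow> complex^'n^'m"
  where "conj_transpose S = (\<chi> i j. cnj (S $ j $ i))"

definition orthonormal_columns :: "complex^'m^'n \<Rightarrow> bool"
  where "orthonormal_columns S \<longleftrightarrow>
    (\<forall>i j. (\<Sum>k\<in>UNIV. cnj (column i S $ k) * column j S $ k) = (if i = j then 1 else 0))"

text \<open>The type class operations on \<^typ>\<open>complex^'n^'n\<close> are componentwise, so neither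
  the library power nor the library exponential is the one for matrices.\<close>

definition matrix_exp :: "complex^'n^'n \<Rightarrow> complex^'n^'n"
  where "matrix_exp M = (\<Sum>k. (1 / fact k) *\<^sub>m (((\<lambda>P. M ** P) ^^ k) (mat 1)))"

definition quantum_walk :: "real \<Rightarrow> complex^'n^'n \<Rightarrow> complex^'n^'n"
  where "quantum_walk t A = matrix_exp ((- \<i> * of_real t) *\<^sub>m A)"


section \<open>Rational functions over the complex numbers\<close>

type_synonym ratfun = "complex poly fract"

definition rf_const :: "complex \<Rightarrow> ratfun"
  where "rf_const c = to_fract [:c:]"

text \<open>The indeterminate, which plays the role of \<open>\<lambda>\<close> or of \<open>s\<close>.\<close>

definition rf_var :: ratfun
  where "rf_var = to_fract [:0, 1:]"

text \<open>The value of a rational function at a point, meant for points that are not poles.\<close>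

definition rf_eval :: "ratfun \<Rightarrow> complex \<Rightarrow> complex"
  where "rf_eval r z = (case quot_of_fract r of (p, q) \<Rightarrow> poly p z / poly q z)"

text \<open>\<open>rf_subst r x\<close> is \<open>r(x)\<close>, the result of replacing the indeterminate of \<open>r\<close> by the
  (nonconstant) rational function \<open>x\<close>.\<close>

definition rf_subst :: "ratfun \<Rightarrow> ratfun \<Rightarrow> ratfun"
  where "rf_subst r x = (case quot_of_fract r of (p, q) \<Rightarrow>
    poly (map_poly rf_const p) x / poly (map_poly rf_const q) x)"

abbreviation rf_matrix :: "complex^'m^'n \<Rightarrow> ratfun^'m^'n"
  where "rf_matrix \<equiv> map_matrix rf_const"

text \<open>The inverses below are inverses of matrices over the field of rational functions.\<close>

definition isospectral_reduction :: "complex^'m^'n \<Rightarrow> complex^'n^'n \<Rightarrow> ratfun^'m^'m"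
  where "isospectral_reduction S A = mat rf_var -
    matrix_inv (rf_matrix (conj_transpose S) ** matrix_inv (mat rf_var - rf_matrix A)
      ** rf_matrix S)"

text \<open>The reduction as a matrix of rational functions, with \<open>x\<close> put in place of \<open>\<lambda>\<close>.\<close>

definition isospectral_reduction_at ::
    "ratfun \<Rightarrow> complex^'m^'n \<Rightarrow> complex^'n^'n \<Rightarrow> ratfun^'m^'m"
  where "isospectral_reduction_at x S A =
    map_matrix (\<lambda>r. rf_subst r x) (isospectral_reduction S A)"


section \<open>The Laplace transform\<close>

definition has_laplace :: "(real \<Rightarrow> complex) \<Rightarrow> complex \<Rightarrow> complex \<Rightarrow> bool"
  where "has_laplace f L s \<longleftrightarrow> ((\<lambda>t. f t * exp (- (s * of_real t))) has_integral L) {0..}"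

definition has_rational_laplace :: "(real \<Rightarrow> complex) \<Rightarrow> ratfun \<Rightarrow> bool"
  where "has_rational_laplace f r \<longleftrightarrow> (\<exists>b. \<forall>s. Re s > b \<longrightarrow> has_laplace f (rf_eval r s) s)"

text \<open>A rational function is determined by its values on a half-plane, so this picks the
  rational function with which the transform of \<open>f\<close> is identified, if there is one.\<close>

definition laplace :: "(real \<Rightarrow> complex) \<Rightarrow> ratfun"
  where "laplace f = (THE r. has_rational_laplace f r)"

text \<open>The transform ignores negative times and null sets; among all preimages of \<open>r\<close> the
  inverse transform is the one that is continuous on \<open>{0..}\<close>, extended by 0 to negative times.\<close>

definition inv_laplace :: "ratfun \<Rightarrow> real \<Rightarrow> complex"
  where "inv_laplace r = (THE f. continuous_on {0..} f \<and> (\<forall>t<0. f t = 0) \<and>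
    has_rational_laplace f r)"

text \<open>Entrywise; \<open>x\<close> is what replaces the transform variable \<open>s\<close>.\<close>

definition laplace_matrix :: "ratfun \<Rightarrow> (real \<Rightarrow> complex^'m^'n) \<Rightarrow> ratfun^'m^'n"
  where "laplace_matrix x F = (\<chi> i j. rf_subst (laplace (\<lambda>t. F t $ i $ j)) x)"

definition inv_laplace_matrix :: "ratfun^'m^'n \<Rightarrow> real \<Rightarrow> complex^'m^'n"
  where "inv_laplace_matrix G t = (\<chi> i j. inv_laplace (G $ i $ j) t)"

end

theory Submission
  imports Defs
begin

text \<open>Put \<open>K\<^sub>B(\<lambda>) = \<Sigma>\<^sup>* (\<lambda> I - B)\<^sup>-\<^sup>1 \<Sigma>\<close>. The reduction of \<open>A\<close> is \<open>\<lambda> I - K\<^sub>A(\<lambda>)\<^sup>-\<^sup>1\<close>, and since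
  \<open>K\<^sub>B(c \<lambda>) = c\<^sup>-\<^sup>1 K\<^sub>C(\<lambda>)\<close> with \<open>C = c\<^sup>-\<^sup>1 B\<close>, both identities reduce to the statement that
  \<open>K\<^sub>B(s)\<close> for \<open>B = - i A\<close> is the Laplace transform of \<open>\<Sigma>\<^sup>* exp(t B) \<Sigma>\<close>, together with Lerch's
  uniqueness theorem. Orthonormality of the columns makes \<open>K\<^sub>B\<close> invertible: if \<open>K\<^sub>B v = 0\<close> and
  \<open>w = (s I - B)\<^sup>-\<^sup>1 \<Sigma> v\<close>, then \<open>w\<^sup>* (s I - B) w = (\<Sigma>\<^sup>* w)\<^sup>* v = 0\<close>, while the real part of the
  left-hand side is positive for large \<open>Re s\<close> unless \<open>w = 0\<close>.\<close>

section \<open>Rational functions\<close>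

lemma ratfun_cases:
  fixes r :: ratfun
  obtains p q where "q \<noteq> 0" "r = to_fract p / to_fract q"
proof
  show "snd (quot_of_fract r) \<noteq> 0" by simp
  show "r = to_fract (fst (quot_of_fract r)) / to_fract (snd (quot_of_fract r))"
    by (metis Fract_conv_to_fract Fract_quot_of_fract)
qed

text \<open>\<open>rf_eval\<close> and \<open>rf_subst\<close> are defined through the reduced pair
  \<open>quot_of_fract\<close>. Cross multiplication links that pair to any other numerator and
  denominator, without reference to common factors.\<close>

lemma quot_of_fract_cross_mult:
  fixes p q :: "complex poly"
  assumes "q \<noteq> 0"
  shows "fst (quot_of_fract (to_fract p / to_fract q)) * q =
         p * snd (quot_of_fract (to_fract p / to_fract q))"
proof -
  define r where "r = to_fract p / to_fract q"
  have "to_fract (fst (quot_of_fract r)) / to_fract (snd (quot_of_fract r)) = r"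
    by (metis Fract_conv_to_fract Fract_quot_of_fract)
  then have "to_fract (fst (quot_of_fract r) * q) = to_fract (p * snd (quot_of_fract r))"
    using assms by (simp add: r_def field_simps)
  then show ?thesis unfolding r_def by (simp only: to_fract_eq_iff)
qed

lemma rf_const_simps [simp]:
  "rf_const 0 = 0" "rf_const 1 = 1"
  "rf_const (a + b) = rf_const a + rf_const b"
  "rf_const (a - b) = rf_const a - rf_const b"
  "rf_const (- a) = - rf_const a"
  "rf_const (a * b) = rf_const a * rf_const b"
  by (simp_all add: rf_const_def one_pCons [symmetric] del: one_pCons
       flip: to_fract_add to_fract_diff to_fract_mult to_fract_uminus)

subsection \<open>Substitution\<close>

lemma poly_map_rf_const: "poly (map_poly rf_const p) (to_fract a) = to_fract (pcompose p a)"
  by (induction p) (simp_all add: map_poly_pCons pcompose_pCons rf_const_def)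

text \<open>Any representing fraction may be substituted into, not only the reduced one: composition
  preserves the cross-multiplied identity, and composing with a nonconstant polynomial sends no
  nonzero denominator to 0.\<close>

lemma rf_subst_fraction:
  assumes "q \<noteq> 0" "degree a > 0"
  shows "rf_subst (to_fract p / to_fract q) (to_fract a) =
         to_fract (pcompose p a) / to_fract (pcompose q a)"
proof -
  define P Q where "P = fst (quot_of_fract (to_fract p / to_fract q))"
    and "Q = snd (quot_of_fract (to_fract p / to_fract q))"
  have "Q \<noteq> 0" by (simp add: Q_def)
  have "P * q = p * Q"
    unfolding P_def Q_def by (rule quot_of_fract_cross_mult) fact
  then have "pcompose P a * pcompose q a = pcompose p a * pcompose Q a"
    by (simp flip: pcompose_mult)
  then have "to_fract (pcompose P a) * to_fract (pcompose q a) =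
      to_fract (pcompose p a) * to_fract (pcompose Q a)"
    by (simp flip: to_fract_mult)
  moreover have "pcompose q a \<noteq> 0" "pcompose Q a \<noteq> 0"
    using assms \<open>Q \<noteq> 0\<close> by (simp_all add: pcompose_eq_0_iff)
  ultimately show ?thesis
    by (simp add: rf_subst_def case_prod_unfold poly_map_rf_const P_def Q_def field_simps)
qed

section \<open>Substitution of a nonconstant polynomial as a homomorphism\<close>

context
  fixes a :: "complex poly"
  assumes deg: "degree a > 0"
begin

lemma rf_subst_const: "rf_subst (rf_const c) (to_fract a) = rf_const c"
  using rf_subst_fraction[of 1 a "[:c:]"] deg by (simp add: rf_const_def pcompose_pCons pcompose_1)

lemma rf_subst_var: "rf_subst rf_var (to_fract a) = to_fract a"
  using rf_subst_fraction[of 1 a "[:0, 1:]"] deg by (simp add: rf_var_def pcompose_pCons pcompose_1)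

lemma rf_subst_add:
  "rf_subst (r1 + r2) (to_fract a) = rf_subst r1 (to_fract a) + rf_subst r2 (to_fract a)"
proof -
  obtain p1 q1 p2 q2 where *: "q1 \<noteq> 0" "r1 = to_fract p1 / to_fract q1"
      "q2 \<noteq> 0" "r2 = to_fract p2 / to_fract q2"
    by (metis ratfun_cases)
  then have r: "r1 + r2 = to_fract (p1 * q2 + p2 * q1) / to_fract (q1 * q2)"
    by (simp add: add_frac_eq)
  have "pcompose q1 a \<noteq> 0" "pcompose q2 a \<noteq> 0"
    using * deg by (simp_all add: pcompose_eq_0_iff)
  moreover have "rf_subst (r1 + r2) (to_fract a) =
      to_fract (pcompose (p1 * q2 + p2 * q1) a) / to_fract (pcompose (q1 * q2) a)"
    unfolding r by (rule rf_subst_fraction) (use * deg in auto)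
  ultimately show ?thesis
    using * deg by (simp add: rf_subst_fraction pcompose_add pcompose_mult add_frac_eq)
qed

lemma rf_subst_mult:
  "rf_subst (r1 * r2) (to_fract a) = rf_subst r1 (to_fract a) * rf_subst r2 (to_fract a)"
proof -
  obtain p1 q1 p2 q2 where *: "q1 \<noteq> 0" "r1 = to_fract p1 / to_fract q1"
      "q2 \<noteq> 0" "r2 = to_fract p2 / to_fract q2"
    by (metis ratfun_cases)
  then have r: "r1 * r2 = to_fract (p1 * p2) / to_fract (q1 * q2)"
    by simp
  have "rf_subst (r1 * r2) (to_fract a) =
      to_fract (pcompose (p1 * p2) a) / to_fract (pcompose (q1 * q2) a)"
    unfolding r by (rule rf_subst_fraction) (use * deg in auto)
  then show ?thesis
    using * deg by (simp add: rf_subst_fraction pcompose_mult)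
qed

lemma rf_subst_0: "rf_subst 0 (to_fract a) = 0"
  using rf_subst_const[of 0] by simp

lemma rf_subst_diff:
  "rf_subst (r1 - r2) (to_fract a) = rf_subst r1 (to_fract a) - rf_subst r2 (to_fract a)"
  using rf_subst_add[of "r1 - r2" r2] by simp

lemma rf_subst_sum:
  "rf_subst (sum f I) (to_fract a) = (\<Sum>i\<in>I. rf_subst (f i) (to_fract a))"
  by (induction I rule: infinite_finite_induct) (simp_all add: rf_subst_0 rf_subst_add)

lemma map_matrix_rf_subst_mult:
  "map_matrix (\<lambda>r. rf_subst r (to_fract a)) (M ** N) =
   map_matrix (\<lambda>r. rf_subst r (to_fract a)) M ** map_matrix (\<lambda>r. rf_subst r (to_fract a)) N"
  by (simp add: vec_eq_iff matrix_matrix_mult_def rf_subst_sum rf_subst_mult)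

lemma map_matrix_rf_subst_diff:
  "map_matrix (\<lambda>r. rf_subst r (to_fract a)) (M - N) =
   map_matrix (\<lambda>r. rf_subst r (to_fract a)) M - map_matrix (\<lambda>r. rf_subst r (to_fract a)) N"
  by (simp add: vec_eq_iff rf_subst_diff)

lemma map_matrix_rf_subst_rf_matrix:
  "map_matrix (\<lambda>r. rf_subst r (to_fract a)) (rf_matrix M) = rf_matrix M"
  by (simp add: vec_eq_iff rf_subst_const)

lemma map_matrix_rf_subst_mat:
  "map_matrix (\<lambda>r. rf_subst r (to_fract a)) (mat c) = mat (rf_subst c (to_fract a))"
  by (simp add: vec_eq_iff mat_def rf_subst_0)

end

subsection \<open>Evaluation on half-planes\<close>

text \<open>Evaluation is compatible with the field operations only away from the poles. Along
  this filter, which ignores any half-plane to the left, it behaves like a field homomorphism.\<close>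

abbreviation far_right :: "complex filter"
  where "far_right \<equiv> filtercomap Re at_top"

lemma eventually_far_right: "eventually P far_right \<longleftrightarrow> (\<exists>b. \<forall>s. Re s > b \<longrightarrow> P s)"
  by (auto simp: eventually_filtercomap eventually_at_top_dense)

lemma far_right_neq_bot [simp]: "far_right \<noteq> bot"
  by (rule filtercomap_neq_bot_surj) (simp, metis Re_complex_of_real surjI)

text \<open>A nonzero polynomial has finitely many roots, so their real parts have an upper
  bound.\<close>

lemma eventually_poly_nonzero:
  assumes "(p :: complex poly) \<noteq> 0"
  shows "\<forall>\<^sub>F s in far_right. poly p s \<noteq> 0"
proof -
  have "finite (Re ` {s. poly p s = 0})"
    using poly_roots_finite[OF assms] by simp
  from bdd_above_finite[OF this] obtain b where "\<And>s. poly p s = 0 \<Longrightarrow> Re s \<le> b"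
    by (auto simp: bdd_above_def)
  then show ?thesis unfolding eventually_far_right by (intro exI[of _ b]) (auto simp: not_le [symmetric])
qed

text \<open>To the right of all roots of \<open>q\<close> and of the reduced denominator, cross
  multiplication shows that both fractions have the same value.\<close>

lemma eventually_rf_eval_fraction:
  assumes "q \<noteq> 0"
  shows "\<forall>\<^sub>F s in far_right. poly q s \<noteq> 0 \<and> rf_eval (to_fract p / to_fract q) s = poly p s / poly q s"
proof -
  define P Q where "P = fst (quot_of_fract (to_fract p / to_fract q))"
    and "Q = snd (quot_of_fract (to_fract p / to_fract q))"
  have "Q \<noteq> 0" by (simp add: Q_def)
  have "P * q = p * Q"
    unfolding P_def Q_def by (rule quot_of_fract_cross_mult) fact
  then have *: "poly P s * poly q s = poly p s * poly Q s" for s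
    by (metis poly_mult)
  show ?thesis
    using eventually_poly_nonzero[OF assms] eventually_poly_nonzero[OF \<open>Q \<noteq> 0\<close>]
  proof eventually_elim
    case (elim s)
    then show ?case using *[of s]
      by (simp add: rf_eval_def case_prod_unfold frac_eq_eq flip: P_def Q_def)
  qed
qed

lemma rf_eval_const [simp]: "rf_eval (rf_const c) s = c"
  by (simp add: rf_eval_def rf_const_def)

lemma rf_eval_var [simp]: "rf_eval rf_var s = s"
  by (simp add: rf_eval_def rf_var_def)

lemma rf_eval_0 [simp]: "rf_eval 0 s = 0"
  using rf_eval_const[of 0] by simp

lemma eventually_rf_eval_add:
  "\<forall>\<^sub>F s in far_right. rf_eval (r1 + r2) s = rf_eval r1 s + rf_eval r2 s"
proof -
  obtain p1 q1 p2 q2 where *: "q1 \<noteq> 0" "r1 = to_fract p1 / to_fract q1"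
      "q2 \<noteq> 0" "r2 = to_fract p2 / to_fract q2"
    by (metis ratfun_cases)
  then have r: "r1 + r2 = to_fract (p1 * q2 + p2 * q1) / to_fract (q1 * q2)"
    by (simp add: add_frac_eq)
  have "q1 * q2 \<noteq> 0" using * by simp
  show ?thesis
    using eventually_rf_eval_fraction[OF *(1), of p1] eventually_rf_eval_fraction[OF *(3), of p2]
      eventually_rf_eval_fraction[OF \<open>q1 * q2 \<noteq> 0\<close>, of "p1 * q2 + p2 * q1"]
    unfolding r *(2,4)[symmetric]
    by eventually_elim (simp add: add_frac_eq del: to_fract_mult to_fract_add)
qed

lemma eventually_rf_eval_diff:
  "\<forall>\<^sub>F s in far_right. rf_eval (r1 - r2) s = rf_eval r1 s - rf_eval r2 s"
  using eventually_rf_eval_add[of "r1 - r2" r2] by eventually_elim simp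

lemma eventually_rf_eval_mult:
  "\<forall>\<^sub>F s in far_right. rf_eval (r1 * r2) s = rf_eval r1 s * rf_eval r2 s"
proof -
  obtain p1 q1 p2 q2 where *: "q1 \<noteq> 0" "r1 = to_fract p1 / to_fract q1"
      "q2 \<noteq> 0" "r2 = to_fract p2 / to_fract q2"
    by (metis ratfun_cases)
  then have r: "r1 * r2 = to_fract (p1 * p2) / to_fract (q1 * q2)"
    by simp
  have "q1 * q2 \<noteq> 0" using * by simp
  show ?thesis
    using eventually_rf_eval_fraction[OF *(1), of p1] eventually_rf_eval_fraction[OF *(3), of p2]
      eventually_rf_eval_fraction[OF \<open>q1 * q2 \<noteq> 0\<close>, of "p1 * p2"]
    unfolding r *(2,4)[symmetric]
    by eventually_elim (simp add: add_frac_eq del: to_fract_mult to_fract_add)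
qed

lemma eventually_rf_eval_sum:
  "\<forall>\<^sub>F s in far_right. rf_eval (sum f I) s = (\<Sum>i\<in>I. rf_eval (f i) s)"
proof (induction I rule: infinite_finite_induct)
  case (insert i I)
  show ?case
    using insert.IH eventually_rf_eval_add[of "f i" "sum f I"]
    by eventually_elim (use insert.hyps in simp)
qed simp_all

lemma eventually_rf_eval_nonzero:
  assumes "r \<noteq> 0"
  shows "\<forall>\<^sub>F s in far_right. rf_eval r s \<noteq> 0"
proof -
  obtain p q where *: "q \<noteq> 0" "r = to_fract p / to_fract q"
    by (rule ratfun_cases)
  then have "p \<noteq> 0" using assms by auto
  show ?thesis
    using eventually_rf_eval_fraction[OF *(1), of p] eventually_poly_nonzero[OF \<open>p \<noteq> 0\<close>]
    unfolding *(2) by eventually_elim simp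
qed

text \<open>A nonzero difference would have no zeros far to the right. This makes the rational
  function chosen by \<open>laplace\<close> unique.\<close>

lemma eventually_rf_eval_eq_imp_eq:
  assumes "\<forall>\<^sub>F s in far_right. rf_eval r1 s = rf_eval r2 s"
  shows "r1 = r2"
proof (rule ccontr)
  assume "r1 \<noteq> r2"
  then have "r1 - r2 \<noteq> 0" by simp
  from assms eventually_rf_eval_nonzero[OF this] eventually_rf_eval_diff[of r1 r2]
  have "\<forall>\<^sub>F s in far_right. False" by eventually_elim simp
  then show False by simp
qed

section \<open>Entrywise evaluation of matrices and vectors\<close>

lemma eventually_rf_eval_matrix_mult:
  "\<forall>\<^sub>F s in far_right. map_matrix (\<lambda>r. rf_eval r s) (M ** N) =
     map_matrix (\<lambda>r. rf_eval r s) M ** map_matrix (\<lambda>r. rf_eval r s) N"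
proof -
  have "\<forall>\<^sub>F s in far_right. rf_eval ((M ** N) $ i $ j) s =
      (map_matrix (\<lambda>r. rf_eval r s) M ** map_matrix (\<lambda>r. rf_eval r s) N) $ i $ j" for i j
  proof -
    have "\<forall>\<^sub>F s in far_right. \<forall>k. rf_eval (M $ i $ k * N $ k $ j) s =
        rf_eval (M $ i $ k) s * rf_eval (N $ k $ j) s"
      by (intro eventually_all_finite eventually_rf_eval_mult)
    with eventually_rf_eval_sum[of "\<lambda>k. M $ i $ k * N $ k $ j" UNIV] show ?thesis
      by eventually_elim (simp add: matrix_matrix_mult_def)
  qed
  then have "\<forall>\<^sub>F s in far_right. \<forall>i j. rf_eval ((M ** N) $ i $ j) s =
      (map_matrix (\<lambda>r. rf_eval r s) M ** map_matrix (\<lambda>r. rf_eval r s) N) $ i $ j"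
    by (intro eventually_all_finite)
  then show ?thesis by eventually_elim (simp add: vec_eq_iff)
qed

lemma eventually_rf_eval_matrix_vector_mult:
  "\<forall>\<^sub>F s in far_right. (\<chi> i. rf_eval ((M *v v) $ i) s) =
     map_matrix (\<lambda>r. rf_eval r s) M *v (\<chi> i. rf_eval (v $ i) s)"
proof -
  have "\<forall>\<^sub>F s in far_right. rf_eval ((M *v v) $ i) s =
      (map_matrix (\<lambda>r. rf_eval r s) M *v (\<chi> i. rf_eval (v $ i) s)) $ i" for i
  proof -
    have "\<forall>\<^sub>F s in far_right. \<forall>k. rf_eval (M $ i $ k * v $ k) s =
        rf_eval (M $ i $ k) s * rf_eval (v $ k) s"
      by (intro eventually_all_finite eventually_rf_eval_mult)
    with eventually_rf_eval_sum[of "\<lambda>k. M $ i $ k * v $ k" UNIV] show ?thesis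
      by eventually_elim (simp add: matrix_vector_mult_def)
  qed
  then have "\<forall>\<^sub>F s in far_right. \<forall>i. rf_eval ((M *v v) $ i) s =
      (map_matrix (\<lambda>r. rf_eval r s) M *v (\<chi> i. rf_eval (v $ i) s)) $ i"
    by (intro eventually_all_finite)
  then show ?thesis by eventually_elim (simp add: vec_eq_iff)
qed

lemma rf_eval_rf_matrix: "map_matrix (\<lambda>r. rf_eval r s) (rf_matrix M) = M"
  by (simp add: vec_eq_iff)

lemma eventually_rf_eval_char_matrix:
  "\<forall>\<^sub>F s in far_right. map_matrix (\<lambda>r. rf_eval r s) (mat rf_var - rf_matrix B) = mat s - B"
proof -
  have "\<forall>\<^sub>F s in far_right. \<forall>i j. rf_eval ((mat rf_var - rf_matrix B) $ i $ j) s = (mat s - B) $ i $ j"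
  proof (intro eventually_all_finite)
    fix i j
    show "\<forall>\<^sub>F s in far_right. rf_eval ((mat rf_var - rf_matrix B) $ i $ j) s = (mat s - B) $ i $ j"
      using eventually_rf_eval_diff[of "mat rf_var $ i $ j" "rf_matrix B $ i $ j"]
      by eventually_elim (simp add: mat_def)
  qed
  then show ?thesis by eventually_elim (simp add: vec_eq_iff)
qed

text \<open>Serves to turn a kernel vector over the rational functions into a nonzero complex kernel
  vector at a suitable point.\<close>

lemma eventually_rf_eval_vector_nonzero:
  fixes v :: "ratfun^'n"
  assumes "v \<noteq> 0"
  shows "\<forall>\<^sub>F s in far_right. (\<chi> i. rf_eval (v $ i) s) \<noteq> 0"
proof -
  obtain i where "v $ i \<noteq> 0" using assms by (auto simp: vec_eq_iff)
  from eventually_rf_eval_nonzero[OF this] show ?thesis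
    by eventually_elim (auto simp: vec_eq_iff)
qed

section \<open>The compressed resolvent\<close>

lemma mat_scale_nth [simp]: "(c *\<^sub>m M) $ i $ j = c * M $ i $ j"
  by (simp add: mat_scale_def)

lemma matrix_mult_nth: "(M ** N) $ i $ j = (\<Sum>k\<in>UNIV. M $ i $ k * N $ k $ j)"
  by (simp add: matrix_matrix_mult_def)

lemma matrix_mult_diff_distrib:
  fixes M :: "'a::ring_1^'n^'m"
  shows "M ** (N - P) = M ** N - M ** P" "(M - Q) ** N = M ** N - Q ** N"
  by (simp_all add: vec_eq_iff matrix_mult_nth algebra_simps sum_subtractf)

lemma mat_scale_mult_left: "(c *\<^sub>m M) ** N = c *\<^sub>m (M ** N)" for M :: "'a::semiring_1^'n^'m"
  by (simp add: vec_eq_iff matrix_matrix_mult_def sum_distrib_left mult.assoc)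

lemma mat_scale_mult_right: "M ** (c *\<^sub>m N) = c *\<^sub>m (M ** N)" for M :: "'a::comm_semiring_1^'n^'m"
  by (simp add: vec_eq_iff matrix_matrix_mult_def sum_distrib_left mult.left_commute)

lemma mat_scale_mat_scale: "c *\<^sub>m (d *\<^sub>m M) = (c * d) *\<^sub>m M" for M :: "'a::semigroup_mult^'n^'m"
  by (simp add: vec_eq_iff mult.assoc)

lemma mat_scale_1 [simp]: "1 *\<^sub>m M = M" for M :: "'a::monoid_mult^'n^'m"
  by (simp add: vec_eq_iff)

text \<open>\<open>matrix_inv\<close> chooses some two-sided inverse. For square matrices over a
  field a right inverse is also a left inverse, which determines the choice.\<close>

lemma matrix_inv_eqI:
  fixes M N :: "'a::field^'n^'n"
  assumes "M ** N = mat 1"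
  shows "matrix_inv M = N"
proof -
  have NM: "N ** M = mat 1" using assms by (simp add: matrix_left_right_inverse)
  then have "\<exists>N. M ** N = mat 1 \<and> N ** M = mat 1" using assms by blast
  then have "M ** matrix_inv M = mat 1" unfolding matrix_inv_def by (rule someI2_ex) simp
  then have "N ** (M ** matrix_inv M) = N" by simp
  then show ?thesis by (simp add: matrix_mul_assoc NM)
qed

lemma matrix_inv_right:
  fixes M :: "'a::field^'n^'n"
  shows "invertible M \<Longrightarrow> M ** matrix_inv M = mat 1"
  by (metis invertible_def matrix_inv_eqI)

lemma matrix_inv_left:
  fixes M :: "'a::field^'n^'n"
  shows "invertible M \<Longrightarrow> matrix_inv M ** M = mat 1"
  by (metis invertible_def matrix_inv_eqI)

lemma invertible_iff_ker:
  fixes M :: "'a::field^'n^'n"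
  shows "invertible M \<longleftrightarrow> (\<forall>x. M *v x = 0 \<longrightarrow> x = 0)"
  by (simp add: invertible_left_inverse matrix_left_invertible_ker)

lemma rf_const_sum: "rf_const (sum f I) = (\<Sum>i\<in>I. rf_const (f i))"
  by (induction I rule: infinite_finite_induct) simp_all

lemma rf_matrix_mult: "rf_matrix (M ** N) = rf_matrix M ** rf_matrix N"
  by (simp add: vec_eq_iff matrix_matrix_mult_def rf_const_sum)

lemma rf_matrix_mat_1 [simp]: "rf_matrix (mat 1) = mat 1"
  by (simp add: vec_eq_iff mat_def)

lemma orthonormal_columns_iff: "orthonormal_columns S \<longleftrightarrow> conj_transpose S ** S = mat 1"
  by (simp add: orthonormal_columns_def vec_eq_iff matrix_matrix_mult_def conj_transpose_def
      column_def mat_def)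

text \<open>A crude bound that serves twice: it controls the quadratic form of a matrix and the
  growth of its powers, so it gives one explicit half-plane for both purposes.\<close>

definition entry_norm :: "complex^'n^'m \<Rightarrow> real"
  where "entry_norm M = (\<Sum>i\<in>UNIV. \<Sum>j\<in>UNIV. cmod (M $ i $ j))"

text \<open>With \<open>q\<close> the squared length of \<open>w\<close>, the identity part
  contributes \<open>Re s * q\<close>, while the form of \<open>B\<close> is at most
  \<open>entry_norm B * q\<close> in modulus, because each product of two coordinates of
  \<open>w\<close> is at most \<open>q\<close>.\<close>

lemma char_matrix_accretive:
  fixes B :: "complex^'n^'n"
  assumes s: "Re s > entry_norm B" and "w \<noteq> 0"
  shows "Re (\<Sum>i\<in>UNIV. cnj (w $ i) * ((mat s - B) *v w) $ i) > 0"
proof -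
  define q where "q = (\<Sum>i\<in>UNIV. (cmod (w $ i))\<^sup>2)"
  obtain i where "w $ i \<noteq> 0" using \<open>w \<noteq> 0\<close> by (auto simp: vec_eq_iff)
  moreover have le_q: "(cmod (w $ i))\<^sup>2 \<le> q" for i
    unfolding q_def by (rule member_le_sum) auto
  ultimately have "q > 0" by (metis less_le_trans zero_less_norm_iff zero_less_power)
  have "cmod (w $ i) \<le> sqrt q" for i
    using le_q[of i] by (simp add: real_le_rsqrt)
  then have "cmod (w $ i) * cmod (w $ j) \<le> sqrt q * sqrt q" for i j
    using \<open>q > 0\<close> by (intro mult_mono) auto
  then have ww: "cmod (w $ i) * cmod (w $ j) \<le> q" for i j
    using \<open>q > 0\<close> by simp
  have "cmod (\<Sum>i\<in>UNIV. cnj (w $ i) * (B *v w) $ i)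
      \<le> (\<Sum>i\<in>UNIV. \<Sum>j\<in>UNIV. cmod (B $ i $ j) * q)"
  proof -
    have "cmod (cnj (w $ i) * (B $ i $ j * w $ j)) \<le> cmod (B $ i $ j) * q" for i j
    proof -
      have "cmod (cnj (w $ i) * (B $ i $ j * w $ j)) = cmod (B $ i $ j) * (cmod (w $ i) * cmod (w $ j))"
        by (simp add: norm_mult)
      then show ?thesis using ww by (simp add: mult_left_mono)
    qed
    then show ?thesis
      unfolding matrix_vector_mult_def
      by (simp add: sum_distrib_left) (intro order.trans[OF norm_sum] sum_mono)
  qed
  then have B: "Re (\<Sum>i\<in>UNIV. cnj (w $ i) * (B *v w) $ i) \<le> entry_norm B * q"
    unfolding entry_norm_def sum_distrib_right by (rule order.trans[OF complex_Re_le_cmod])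
  have "(mat s *v w) $ i = s * w $ i" for i
    by (simp add: matrix_vector_mult_def mat_def if_distrib[where f="\<lambda>x. x * _"] cong: if_cong)
  then have "(\<Sum>i\<in>UNIV. cnj (w $ i) * (mat s *v w) $ i) = s * of_real q"
    unfolding q_def of_real_sum sum_distrib_left complex_norm_square
    by (simp add: mult_ac)
  then have "Re (\<Sum>i\<in>UNIV. cnj (w $ i) * ((mat s - B) *v w) $ i) =
      Re s * q - Re (\<Sum>i\<in>UNIV. cnj (w $ i) * (B *v w) $ i)"
    by (simp add: matrix_vector_mult_diff_rdistrib right_diff_distrib sum_subtractf)
  with B mult_strict_right_mono[OF s \<open>q > 0\<close>] show "Re (\<Sum>i\<in>UNIV. cnj (w $ i) * ((mat s - B) *v w) $ i) > 0"
    by linarith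
qed

text \<open>The threshold for \<open>Re s\<close> does not depend on \<open>w\<close>, so it also
  covers vectors that themselves depend on \<open>s\<close>.\<close>

lemma eventually_accretive:
  "\<forall>\<^sub>F s in far_right. \<forall>w. w \<noteq> 0 \<longrightarrow> Re (\<Sum>i\<in>UNIV. cnj (w $ i) * ((mat s - B) *v w) $ i) > 0"
  unfolding eventually_far_right using char_matrix_accretive by blast

text \<open>A nonzero kernel vector of rational functions, evaluated far to the right, would be a
  nonzero kernel vector of \<open>mat s - B\<close>, against positivity of the form.\<close>

lemma invertible_char_matrix:
  fixes B :: "complex^'n^'n"
  shows "invertible (mat rf_var - rf_matrix B)"
  unfolding invertible_iff_ker
proof (intro allI impI, rule ccontr)
  fix v :: "ratfun^'n"
  assume 0: "(mat rf_var - rf_matrix B) *v v = 0" and "v \<noteq> 0"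
  have "\<forall>\<^sub>F s in far_right. False"
    using eventually_accretive[of B] eventually_rf_eval_vector_nonzero[OF \<open>v \<noteq> 0\<close>]
      eventually_rf_eval_char_matrix[of B]
      eventually_rf_eval_matrix_vector_mult[of "mat rf_var - rf_matrix B" v]
  proof eventually_elim
    case (elim s)
    from elim(4) have "(mat s - B) *v (\<chi> i. rf_eval (v $ i) s) = 0"
      unfolding elim(3) by (simp add: 0 vec_eq_iff)
    with elim(1,2) show False by fastforce
  qed
  then show False by simp
qed

definition compressed_resolvent :: "complex^'m^'n \<Rightarrow> complex^'n^'n \<Rightarrow> ratfun^'m^'m"
  where "compressed_resolvent S B =
    rf_matrix (conj_transpose S) ** matrix_inv (mat rf_var - rf_matrix B) ** rf_matrix S"

lemma invertible_compressed_resolvent: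
  fixes S :: "complex^'m^'n"
  assumes "orthonormal_columns S"
  shows "invertible (compressed_resolvent S B)"
  unfolding invertible_iff_ker
proof (intro allI impI, rule ccontr)
  fix v :: "ratfun^'m"
  assume 0: "compressed_resolvent S B *v v = 0" and "v \<noteq> 0"
  define w where "w = matrix_inv (mat rf_var - rf_matrix B) *v (rf_matrix S *v v)"
  have Sw: "rf_matrix (conj_transpose S) *v w = 0"
    using 0 by (simp add: w_def compressed_resolvent_def matrix_vector_mul_assoc matrix_mul_assoc)
  have w: "(mat rf_var - rf_matrix B) *v w = rf_matrix S *v v"
    unfolding w_def
    by (simp add: matrix_vector_mul_assoc matrix_mul_assoc matrix_inv_right invertible_char_matrix)
  \<comment> \<open>This is where orthonormality enters: \<open>w = 0\<close> forces
    \<open>S v = 0\<close>, and multiplying by the conjugate transpose of \<open>S\<close> gives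
    \<open>v = 0\<close>.\<close>
  have "w \<noteq> 0"
  proof
    assume "w = 0"
    then have "rf_matrix (conj_transpose S) *v (rf_matrix S *v v) = 0"
      by (simp flip: w)
    then show False
      using \<open>v \<noteq> 0\<close> assms
      by (simp add: matrix_vector_mul_assoc orthonormal_columns_iff flip: rf_matrix_mult)
  qed
  have "\<forall>\<^sub>F s in far_right. False"
    using eventually_accretive[of B] eventually_rf_eval_vector_nonzero[OF \<open>w \<noteq> 0\<close>]
      eventually_rf_eval_char_matrix[of B]
      eventually_rf_eval_matrix_vector_mult[of "mat rf_var - rf_matrix B" w]
      eventually_rf_eval_matrix_vector_mult[of "rf_matrix S" v]
      eventually_rf_eval_matrix_vector_mult[of "rf_matrix (conj_transpose S)" w]
  proof eventually_elim
    case (elim s)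
    define u where "u = (\<chi> i. rf_eval (w $ i) s)"
    define y where "y = (\<chi> i. rf_eval (v $ i) s)"
    have u: "(mat s - B) *v u = S *v y"
      using elim(3-5) by (simp add: w rf_eval_rf_matrix u_def y_def)
    have "conj_transpose S *v u = 0"
      using elim(6) by (simp add: Sw rf_eval_rf_matrix u_def vec_eq_iff)
    then have "(\<Sum>i\<in>UNIV. cnj (S $ i $ k) * u $ i) = 0" for k
      by (simp add: vec_eq_iff matrix_vector_mult_def conj_transpose_def)
    then have *: "(\<Sum>i\<in>UNIV. cnj (u $ i) * S $ i $ k) = 0" for k
      by (rule_tac complex_cnj_cancel_iff[THEN iffD1]) (simp add: mult.commute)
    \<comment> \<open>Exchanging the sums moves \<open>S\<close> from \<open>y\<close> to
      \<open>u\<close>, where \<open>*\<close> makes every inner sum vanish.\<close>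
    have "(\<Sum>i\<in>UNIV. cnj (u $ i) * (S *v y) $ i) =
        (\<Sum>k\<in>UNIV. (\<Sum>i\<in>UNIV. cnj (u $ i) * S $ i $ k) * y $ k)"
      unfolding matrix_vector_mult_def
      by (simp add: sum_distrib_left sum_distrib_right mult.assoc) (rule sum.swap)
    then have "(\<Sum>i\<in>UNIV. cnj (u $ i) * ((mat s - B) *v u) $ i) = 0"
      unfolding u by (simp add: *)
    moreover have "u \<noteq> 0" using elim(2) by (simp add: u_def)
    ultimately show False using elim(1)[rule_format, of u] by simp
  qed
  then show False by simp
qed

lemma rf_subst_compressed_resolvent:
  assumes "c \<noteq> 0"
  shows "map_matrix (\<lambda>r. rf_subst r (rf_const c * rf_var)) (compressed_resolvent S B) =
         rf_const (inverse c) *\<^sub>m compressed_resolvent S (inverse c *\<^sub>m B)"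
proof -
  define a where "a = [:0, c:]"
  have a: "degree a > 0" using assms by (simp add: a_def)
  have x: "rf_const c * rf_var = to_fract a"
    by (simp add: rf_const_def rf_var_def a_def flip: to_fract_mult)
  have c: "rf_const c * rf_const (inverse c) = 1"
    using assms by (simp flip: rf_const_simps)
  \<comment> \<open>Substitution is applied to the equation that defines the inverse, so
    \<open>\<sigma>\<close> is recognised as the inverse of the substituted matrix, from which the
    factor \<open>c\<close> is then pulled out.\<close>
  define \<sigma> where "\<sigma> = map_matrix (\<lambda>r. rf_subst r (to_fract a)) (matrix_inv (mat rf_var - rf_matrix B))"
  have scale: "mat (to_fract a) - rf_matrix B = rf_const c *\<^sub>m (mat rf_var - rf_matrix (inverse c *\<^sub>m B))"
    using assms by (simp add: vec_eq_iff mat_def right_diff_distrib c flip: x mult.assoc)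
  have "map_matrix (\<lambda>r. rf_subst r (to_fract a))
      ((mat rf_var - rf_matrix B) ** matrix_inv (mat rf_var - rf_matrix B)) = mat 1"
    using rf_subst_const[OF a, of 1]
    by (simp add: matrix_inv_right invertible_char_matrix map_matrix_rf_subst_mat[OF a])
  then have "(mat (to_fract a) - rf_matrix B) ** \<sigma> = mat 1"
    by (simp add: \<sigma>_def a map_matrix_rf_subst_mult map_matrix_rf_subst_diff
        map_matrix_rf_subst_mat map_matrix_rf_subst_rf_matrix rf_subst_var)
  then have "matrix_inv (mat rf_var - rf_matrix (inverse c *\<^sub>m B)) = rf_const c *\<^sub>m \<sigma>"
    unfolding scale by (intro matrix_inv_eqI) (simp add: mat_scale_mult_left mat_scale_mult_right)
  then have "compressed_resolvent S (inverse c *\<^sub>m B) =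
      rf_const c *\<^sub>m (rf_matrix (conj_transpose S) ** \<sigma> ** rf_matrix S)"
    by (simp add: compressed_resolvent_def mat_scale_mult_left mat_scale_mult_right)
  then show ?thesis
    by (simp add: compressed_resolvent_def \<sigma>_def x a map_matrix_rf_subst_mult
        map_matrix_rf_subst_rf_matrix mat_scale_mat_scale c mult.commute[of "rf_const (inverse c)"]
        del: rf_const_simps)
qed

section \<open>Improper integrals over the half-line\<close>

text \<open>A box around a large ball meets the half-line in some \<open>{0..b}\<close>, where the
  integral is \<open>G b\<close>.\<close>

lemma has_integral_atLeast_0I:
  fixes f :: "real \<Rightarrow> 'a::banach"
  assumes f: "\<And>T. T \<ge> 0 \<Longrightarrow> (f has_integral G T) {0..T}" and G: "(G \<longlongrightarrow> L) at_top"
  shows "(f has_integral L) {0..}"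
  unfolding has_integral_alt'
proof (intro conjI allI impI)
  fix a b :: real
  \<comment> \<open>The box may lie left of 0, hence the maximum.\<close>
  have "f integrable_on {0..max 0 b}"
    using f[of "max 0 b"] by auto
  then have "f integrable_on {max 0 a..b}"
    by (rule integrable_on_subinterval) auto
  moreover have "{0..} \<inter> cbox a b = {max 0 a..b}" by auto
  ultimately show "(\<lambda>x. if x \<in> {0..} then f x else 0) integrable_on cbox a b"
    by (simp only: integrable_restrict_Int)
next
  fix e :: real
  assume "e > 0"
  then obtain N where N: "\<And>T. T \<ge> N \<Longrightarrow> norm (G T - L) < e"
    using G by (auto simp: tendsto_iff eventually_at_top_linorder dist_norm)
  show "\<exists>B>0. \<forall>a b. ball 0 B \<subseteq> cbox a b \<longrightarrow>
      norm (integral (cbox a b) (\<lambda>x. if x \<in> {0..} then f x else 0) - L) < e"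
  \<comment> \<open>The extra 1 puts both 0 and \<open>max 0 N\<close> inside the open ball, so
    \<open>a \<le> 0\<close> and \<open>b \<ge> N\<close>.\<close>
  proof (intro exI[of _ "max 0 N + 1"] conjI allI impI)
    fix a b :: real
    assume *: "ball 0 (max 0 N + 1) \<subseteq> cbox a b"
    have "max 0 N \<in> ball 0 (max 0 N + 1)" "0 \<in> ball 0 (max 0 N + 1)" by auto
    with * have "max 0 N \<in> cbox a b" "0 \<in> cbox a b" by blast+
    then have ab: "a \<le> 0" "max 0 N \<le> b" by simp_all
    then have "{0..} \<inter> cbox a b = {0..b}" by auto
    then have "integral (cbox a b) (\<lambda>x. if x \<in> {0..} then f x else 0) = integral {0..b} f"
      by (simp only: integral_restrict_Int)
    also have "\<dots> = G b" using f ab by (simp add: integral_unique)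
    finally show "norm (integral (cbox a b) (\<lambda>x. if x \<in> {0..} then f x else 0) - L) < e"
      using N ab by simp
  qed auto
qed

text \<open>Apply the definition to the symmetric boxes from \<open>- T\<close> to
  \<open>T\<close>.\<close>

lemma has_integral_atLeast_0D:
  fixes f :: "real \<Rightarrow> 'a::banach"
  assumes "(f has_integral L) {0..}"
  shows "((\<lambda>T. integral {0..T} f) \<longlongrightarrow> L) at_top"
  unfolding tendsto_iff
proof (intro allI impI)
  fix e :: real
  assume "e > 0"
  with assms obtain B where B: "B > 0" "\<And>a b. ball 0 B \<subseteq> cbox a b \<Longrightarrow>
      norm (integral (cbox a b) (\<lambda>x. if x \<in> {0..} then f x else 0) - L) < e"
    unfolding has_integral_alt' by meson
  have "dist (integral {0..T} f) L < e" if "T \<ge> B" for T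
  proof -
    have "{0..} \<inter> cbox (- T) T = {0..T}" using that B by auto
    then have "integral (cbox (- T) T) (\<lambda>x. if x \<in> {0..} then f x else 0) = integral {0..T} f"
      by (simp only: integral_restrict_Int)
    moreover have "ball 0 B \<subseteq> cbox (- T) T" using that by (auto simp: dist_norm)
    ultimately show ?thesis using B(2)[of "- T" T] by (simp add: dist_norm)
  qed
  then show "\<forall>\<^sub>F T in at_top. dist (integral {0..T} f) L < e"
    unfolding eventually_at_top_linorder by blast
qed

section \<open>The Laplace transform of the matrix exponential\<close>

abbreviation mat_power :: "complex^'n^'n \<Rightarrow> nat \<Rightarrow> complex^'n^'n"
  where "mat_power M k \<equiv> ((\<lambda>P. M ** P) ^^ k) (mat 1)"

lemma mat_power_scale: "mat_power (c *\<^sub>m M) k = (c ^ k) *\<^sub>m mat_power M k"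
  by (induction k) (simp_all add: mat_scale_mult_left mat_scale_mult_right mat_scale_mat_scale mult.commute)

text \<open>Powers grow by multiplication on the left, so the column \<open>j\<close> stays fixed
  while the row must vary in the induction. The bound lets the exponential series dominate each
  entry.\<close>

lemma mat_power_bound: "cmod (mat_power M k $ i $ j) \<le> entry_norm M ^ k"
proof (induction k arbitrary: i)
  case 0
  then show ?case by (simp add: mat_def)
next
  case (Suc k)
  have "entry_norm M \<ge> 0" by (simp add: entry_norm_def sum_nonneg)
  have "mat_power M (Suc k) $ i $ j = (\<Sum>l\<in>UNIV. M $ i $ l * mat_power M k $ l $ j)"
    by (simp add: matrix_matrix_mult_def)
  also have "cmod \<dots> \<le> (\<Sum>l\<in>UNIV. cmod (M $ i $ l) * entry_norm M ^ k)"
    by (intro order.trans[OF norm_sum] sum_mono) (simp add: norm_mult mult_left_mono Suc.IH)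
  also have "\<dots> = (\<Sum>l\<in>UNIV. cmod (M $ i $ l)) * entry_norm M ^ k"
    by (simp add: sum_distrib_right)
  also have "\<dots> \<le> entry_norm M * entry_norm M ^ k"
  proof (rule mult_right_mono)
    show "(\<Sum>l\<in>UNIV. cmod (M $ i $ l)) \<le> entry_norm M"
      unfolding entry_norm_def by (rule member_le_sum) (auto intro: sum_nonneg)
  qed (use \<open>entry_norm M \<ge> 0\<close> in simp)
  finally show ?case by simp
qed

lemma mat_power_term_bound:
  "norm (mat_power M k $ i $ j / fact k * z ^ k) \<le> (entry_norm M * cmod z) ^ k /\<^sub>R fact k"
  using mult_right_mono[OF mat_power_bound[where M = M and k = k and i = i and j = j], of "cmod z ^ k / fact k"]
  by (simp add: norm_mult norm_divide norm_power power_mult_distrib divide_simps mult_ac)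

lemma summable_mat_power: "summable (\<lambda>k. mat_power M k $ i $ j / fact k * z ^ k)"
  by (rule summable_comparison_test'[OF sums_summable[OF exp_converges]])
     (rule mat_power_term_bound)

text \<open>Reduces the matrix exponential to scalar power series in \<open>z\<close>, to which
  termwise differentiation applies.\<close>

lemma matrix_exp_scale_nth:
  "matrix_exp (z *\<^sub>m M) $ i $ j = (\<Sum>k. mat_power M k $ i $ j / fact k * z ^ k)"
proof -
  have "(\<lambda>k. (1 / fact k) *\<^sub>m mat_power (z *\<^sub>m M) k) sums
      (\<chi> i j. \<Sum>k. mat_power M k $ i $ j / fact k * z ^ k)"
    unfolding sums_def
  proof (intro vec_tendstoI)
    fix i j
    show "(\<lambda>n. (\<Sum>k<n. (1 / fact k) *\<^sub>m mat_power (z *\<^sub>m M) k) $ i $ j) \<longlonglongrightarrow>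
        (\<chi> i j. \<Sum>k. mat_power M k $ i $ j / fact k * z ^ k) $ i $ j"
      using summable_LIMSEQ[OF summable_mat_power[where M = M and i = i and j = j and z = z]]
      by (simp add: mat_power_scale mult_ac)
  qed
  from sums_unique[OF this, symmetric] show ?thesis by (simp add: matrix_exp_def)
qed

lemma matrix_exp_0: "matrix_exp (0 *\<^sub>m M) = mat 1"
  unfolding vec_eq_iff matrix_exp_scale_nth powser_zero by simp

lemma matrix_exp_bound: "cmod (matrix_exp (z *\<^sub>m M) $ i $ j) \<le> exp (entry_norm M * cmod z)"
  unfolding matrix_exp_scale_nth exp_def
proof (rule norm_suminf_le)
  show "summable (\<lambda>k. (entry_norm M * cmod z) ^ k /\<^sub>R fact k)"
    by (rule sums_summable[OF exp_converges])
qed (rule mat_power_term_bound)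

lemma matrix_exp_has_field_derivative:
  "((\<lambda>z. matrix_exp (z *\<^sub>m M) $ i $ j) has_field_derivative
     (M ** matrix_exp (z *\<^sub>m M)) $ i $ j) (at z)"
proof -
  define a where "a i k = mat_power M k $ i $ j / fact k" for i k
  have sm: "summable (\<lambda>k. a i k * y ^ k)" for i y
    unfolding a_def by (rule summable_mat_power)
  have E: "matrix_exp (z *\<^sub>m M) $ l $ j = (\<Sum>k. a l k * z ^ k)" for l z
    by (simp add: matrix_exp_scale_nth a_def)
  \<comment> \<open>The factor \<open>k + 1\<close> from differentiation cancels against the
    factorial. Splitting off one left factor \<open>M\<close> then expresses the new coefficients
    through the old ones.\<close>
  have "diffs (a i) k = mat_power M (Suc k) $ i $ j / fact k" for k
    by (simp add: diffs_def a_def del: of_nat_Suc funpow.simps)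
  then have "diffs (a i) k = (\<Sum>l\<in>UNIV. M $ i $ l * a l k)" for k
    by (simp add: a_def matrix_mult_nth sum_divide_distrib)
  then have "(\<Sum>k. diffs (a i) k * z ^ k) = (\<Sum>k. \<Sum>l\<in>UNIV. M $ i $ l * (a l k * z ^ k))"
    by (simp add: sum_distrib_right mult.assoc)
  also have "\<dots> = (\<Sum>l\<in>UNIV. \<Sum>k. M $ i $ l * (a l k * z ^ k))"
    by (intro suminf_sum summable_mult sm)
  also have "\<dots> = (M ** matrix_exp (z *\<^sub>m M)) $ i $ j"
    by (simp add: suminf_mult sm matrix_mult_nth E)
  finally show ?thesis
    using termdiffs_strong_converges_everywhere[of "a i" z, OF sm]
    by (simp add: E)
qed

text \<open>\<open>F\<close> is an entry of \<open>- W exp(t M) exp(- s t)\<close>, an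
  antiderivative of the integrand because \<open>W (s I - M) = I\<close>. It tends to 0 since
  \<open>Re s\<close> exceeds the growth rate, and \<open>- F 0\<close> is the entry of
  \<open>W\<close>.\<close>

lemma has_laplace_matrix_exp:
  assumes W: "W ** (mat s - M) = mat 1" and s: "Re s > entry_norm M"
  shows "has_laplace (\<lambda>t. matrix_exp (of_real t *\<^sub>m M) $ i $ j) (W $ i $ j) s"
proof -
  define E where "E t = matrix_exp (of_real t *\<^sub>m M)" for t :: real
  define F where "F t = - ((W ** E t) $ i $ j * exp (- (s * of_real t)))" for t :: real
  have dE: "((\<lambda>t. E t $ k $ j) has_vector_derivative (M ** E t) $ k $ j) (at t within X)" for k t X
    using has_vector_derivative_real_field[OF matrix_exp_has_field_derivative[of M k j "of_real t"]]
    by (simp add: E_def)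
  have dWE: "((\<lambda>t. (W ** E t) $ i $ j) has_vector_derivative (W ** M ** E t) $ i $ j) (at t within X)"
    for t X
    unfolding matrix_mul_assoc[symmetric] matrix_mult_nth[of W]
    by (auto intro!: derivative_eq_intros dE)
  have dexp: "((\<lambda>t. exp (- (s * of_real t))) has_vector_derivative - s * exp (- (s * of_real t))) (at t within X)"
    for t X
    by (rule has_vector_derivative_real_field) (auto intro!: derivative_eq_intros)
  have EW: "s * (W ** E t) $ i $ j - (W ** M ** E t) $ i $ j = E t $ i $ j" for t
  proof -
    have "W ** mat s = s *\<^sub>m W"
      by (simp add: vec_eq_iff matrix_matrix_mult_def mat_def if_distrib[where f="\<lambda>x. _ * x"]
          mult.commute cong: if_cong)
    then have "s *\<^sub>m (W ** E t) - W ** M ** E t = E t"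
      using arg_cong[OF W, of "\<lambda>X. X ** E t"]
      by (simp add: matrix_mult_diff_distrib mat_scale_mult_left)
    from arg_cong[OF this, of "\<lambda>X. X $ i $ j"] show ?thesis by simp
  qed
  have "(F has_vector_derivative E t $ i $ j * exp (- (s * of_real t))) (at t within X)" for t X
    unfolding F_def
    by (rule has_vector_derivative_eq_rhs[OF has_vector_derivative_minus[OF
        has_vector_derivative_mult[OF dWE dexp]]])
       (simp add: algebra_simps flip: EW)
  then have "((\<lambda>t. E t $ i $ j * exp (- (s * of_real t))) has_integral F T - F 0) {0..T}" if "T \<ge> 0" for T
    using that by (intro fundamental_theorem_of_calculus) auto
  moreover have "((\<lambda>T. F T - F 0) \<longlongrightarrow> 0 - F 0) at_top"
  proof (intro tendsto_intros)
    have "((\<lambda>t. E t $ k $ j * exp (- (s * of_real t))) \<longlongrightarrow> 0) at_top" for k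
    proof (rule Lim_null_comparison)
      show "\<forall>\<^sub>F t in at_top. norm (E t $ k $ j * exp (- (s * of_real t))) \<le> exp ((entry_norm M - Re s) * t)"
        using eventually_ge_at_top[of 0]
      proof eventually_elim
        case (elim t)
        then have "cmod (E t $ k $ j) \<le> exp (entry_norm M * t)"
          using matrix_exp_bound[of "of_real t" M k j] by (simp add: E_def)
        then show ?case
          by (simp add: norm_mult norm_divide exp_diff exp_minus left_diff_distrib divide_simps)
      qed
      show "((\<lambda>t. exp ((entry_norm M - Re s) * t)) \<longlongrightarrow> 0) at_top"
        using s by (intro filterlim_compose[OF exp_at_bot] filterlim_ident
            filterlim_tendsto_neg_mult_at_bot[OF tendsto_const]) auto
    qed
    then have "((\<lambda>t. - (\<Sum>k\<in>UNIV. W $ i $ k * (E t $ k $ j * exp (- (s * of_real t)))))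
        \<longlongrightarrow> - (\<Sum>k\<in>UNIV. W $ i $ k * 0)) at_top"
      by (intro tendsto_intros)
    then show "(F \<longlongrightarrow> 0) at_top"
      by (simp add: F_def[abs_def] matrix_mult_nth sum_distrib_right mult.assoc)
  qed
  moreover have "F 0 = - W $ i $ j"
    using matrix_exp_0[of M] by (simp add: F_def E_def)
  ultimately show ?thesis
    unfolding has_laplace_def E_def[symmetric] using has_integral_atLeast_0I by fastforce
qed

section \<open>Uniqueness of the inverse transform\<close>

text \<open>Integration by parts: \<open>k\<close> times the transform of the primitive
  \<open>G\<close> is the transform of \<open>q\<close> minus the boundary term
  \<open>G T * exp (- (k * T))\<close>. This passes from \<open>q\<close>, about whose decay nothing
  is known, to \<open>G\<close>, which tends to 0.\<close>

lemma integral_transform_tendsto_0: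
  fixes q :: "real \<Rightarrow> real"
  assumes cont: "continuous_on {0..} q"
    and int: "((\<lambda>t. q t * exp (- (k * t))) has_integral 0) {0..}"
    and lim: "((\<lambda>T. integral {0..T} q) \<longlongrightarrow> 0) at_top" and k: "k > 0"
  shows "((\<lambda>T. integral {0..T} (\<lambda>t. integral {0..t} q * exp (- (k * t)))) \<longlongrightarrow> 0) at_top"
proof -
  define G where "G t = integral {0..t} q" for t
  have dG: "(G has_real_derivative q t) (at t within {0..T})" if "t \<in> {0..T}" for t T
    unfolding G_def has_real_derivative_iff_has_vector_derivative
    using that by (intro integral_has_vector_derivative continuous_on_subset[OF cont]) auto
  then have contG: "continuous_on {0..T} G" for T
    by (meson DERIV_continuous_on)
  have contq: "continuous_on {0..T} q" for T
    by (rule continuous_on_subset[OF cont]) auto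
  have "integral {0..T} (\<lambda>t. G t * exp (- (k * t))) =
      (integral {0..T} (\<lambda>t. q t * exp (- (k * t))) - G T * exp (- (k * T))) / k" if "T \<ge> 0" for T
  proof -
    have "((\<lambda>t. q t * exp (- (k * t)) - k * (G t * exp (- (k * t)))) has_integral
        G T * exp (- (k * T)) - G 0 * exp (- (k * 0))) {0..T}"
    proof (rule fundamental_theorem_of_calculus[OF that])
      fix t assume "t \<in> {0..T}"
      then show "((\<lambda>t. G t * exp (- (k * t))) has_vector_derivative
          q t * exp (- (k * t)) - k * (G t * exp (- (k * t)))) (at t within {0..T})"
        unfolding has_real_derivative_iff_has_vector_derivative[symmetric]
        by (auto intro!: derivative_eq_intros dG simp: algebra_simps)
    qed
    moreover have "((\<lambda>t. q t * exp (- (k * t)) - k * (G t * exp (- (k * t)))) has_integral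
        integral {0..T} (\<lambda>t. q t * exp (- (k * t))) -
        k * integral {0..T} (\<lambda>t. G t * exp (- (k * t)))) {0..T}"
      by (intro has_integral_diff has_integral_mult_right integrable_integral
          integrable_continuous_interval continuous_intros contq contG)
    ultimately have "G T * exp (- (k * T)) - G 0 * exp (- (k * 0)) =
        integral {0..T} (\<lambda>t. q t * exp (- (k * t))) -
        k * integral {0..T} (\<lambda>t. G t * exp (- (k * t)))"
      by (rule has_integral_unique)
    then show ?thesis using k by (simp add: G_def field_simps)
  qed
  then have "\<forall>\<^sub>F T in at_top. (integral {0..T} (\<lambda>t. q t * exp (- (k * t))) - G T * exp (- (k * T))) / k =
      integral {0..T} (\<lambda>t. G t * exp (- (k * t)))"
    by (intro eventually_mono[OF eventually_ge_at_top[of 0]]) simp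
  moreover have "((\<lambda>T. (integral {0..T} (\<lambda>t. q t * exp (- (k * t))) - G T * exp (- (k * T))) / k)
      \<longlongrightarrow> (0 - 0) / k) at_top"
  proof (intro tendsto_intros has_integral_atLeast_0D[OF int])
    show "((\<lambda>T. G T * exp (- (k * T))) \<longlongrightarrow> 0) at_top"
    proof (rule Lim_null_comparison)
      show "\<forall>\<^sub>F T in at_top. norm (G T * exp (- (k * T))) \<le> \<bar>G T\<bar>"
        using eventually_ge_at_top[of 0]
        by eventually_elim (use k in \<open>simp add: abs_mult mult_left_le\<close>)
      show "((\<lambda>T. \<bar>G T\<bar>) \<longlongrightarrow> 0) at_top"
        using lim unfolding G_def by (rule tendsto_rabs_zero)
    qed
  qed (use k in simp)
  ultimately show ?thesis
    unfolding G_def by (simp add: tendsto_cong)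
qed

text \<open>In the variable \<open>x = exp (- t)\<close> the moments of \<open>G\<close> vanish, so Weierstrass approximation
  shows that \<open>G\<close> is orthogonal to itself.\<close>

lemma vanishing_moments_imp_zero:
  fixes G :: "real \<Rightarrow> real"
  assumes cont: "continuous_on {0..} G" and lim: "(G \<longlongrightarrow> 0) at_top"
    and moments: "\<And>k. ((\<lambda>T. integral {0..T} (\<lambda>t. G t * exp (- (real (Suc k) * t)))) \<longlongrightarrow> 0) at_top"
    and "t \<ge> 0"
  shows "G t = 0"
proof -
  have contG: "continuous_on {0..T} G" for T
    by (rule continuous_on_subset[OF cont]) auto
  \<comment> \<open>The point \<open>x = 0\<close> corresponds to infinite time; the value 0 there
    is continuous because \<open>G\<close> tends to 0.\<close>
  define \<phi> where "\<phi> x = (if x \<le> 0 then 0 else G (- ln x))" for x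
  have cont_phi: "continuous_on {0..1} \<phi>"
    unfolding continuous_on_def
  proof
    fix x :: real
    assume x: "x \<in> {0..1}"
    have ev: "\<forall>\<^sub>F y in at_right 0. G (- ln y) = \<phi> y"
      by (auto simp: eventually_at_filter \<phi>_def)
    show "(\<phi> \<longlongrightarrow> \<phi> x) (at x within {0..1})"
    proof (cases "x = 0")
      case True
      have "((\<lambda>y. G (- ln y)) \<longlongrightarrow> 0) (at_right 0)"
        by (rule filterlim_compose[OF lim])
           (auto intro: filterlim_compose[OF filterlim_uminus_at_top_at_bot ln_at_0])
      then have "(\<phi> \<longlongrightarrow> 0) (at_right 0)"
        using tendsto_cong[OF ev] by simp
      then show ?thesis
        using True by (simp add: at_within_Icc_at_right \<phi>_def)
    next
      case False
      with x have "x > 0" by simp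
      have "continuous_on {0<..1} (\<lambda>y. G (- ln y))"
        by (rule continuous_on_compose2[OF cont]) (auto intro!: continuous_intros)
      then have "((\<lambda>y. G (- ln y)) \<longlongrightarrow> G (- ln x)) (at x within {0<..1})"
        using x \<open>x > 0\<close> by (simp add: continuous_on_def)
      moreover have "\<forall>\<^sub>F y in at x within {0<..1}. G (- ln y) = \<phi> y"
        by (auto simp: eventually_at_filter \<phi>_def)
      ultimately have "(\<phi> \<longlongrightarrow> \<phi> x) (at x within {0<..1})"
        using tendsto_cong \<open>x > 0\<close> by (fastforce simp: \<phi>_def)
      moreover have "at x within {0..1} = at x within {0<..1}"
        using \<open>x > 0\<close> by (intro at_within_nhd[of x "{0<..}"]) auto
      ultimately show ?thesis by simp
    qed
  qed
  then have "compact (\<phi> ` {0..1})"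
    by (intro compact_continuous_image) auto
  then obtain M where M: "\<And>x. x \<in> {0..1} \<Longrightarrow> \<bar>\<phi> x\<bar> \<le> M"
    by (metis bounded_iff compact_imp_bounded imageI real_norm_def)
  have phi_exp: "\<phi> (exp (- t)) = G t" for t by (simp add: \<phi>_def)
  have GM: "\<bar>G t\<bar> \<le> M" if "t \<ge> 0" for t
    using M[of "exp (- t)"] that by (simp add: phi_exp)
  then have "M \<ge> 0" by (metis abs_ge_zero order.trans order_refl)
  \<comment> \<open>The weight \<open>exp (- t)\<close> comes from the change of variable, so this
    is the square integral of \<open>\<phi>\<close> over the interval from \<open>exp (- T)\<close>
    to 1.\<close>
  define I where "I T = integral {0..T} (\<lambda>t. (G t)\<^sup>2 * exp (- t))" for T
  have I_le: "I T \<le> e * M" if "T \<ge> 0" "e > 0" for e T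
  proof -
    obtain g where g: "real_polynomial_function g" "\<And>x. x \<in> {0..1} \<Longrightarrow> \<bar>\<phi> x - g x\<bar> < e"
      using Stone_Weierstrass_real_polynomial_function[OF _ cont_phi \<open>e > 0\<close>] by auto
    then obtain a n where g_eq: "g = (\<lambda>x. \<Sum>i\<le>n. a i * x ^ i)"
      by (auto simp: real_polynomial_function_iff_sum)
    \<comment> \<open>\<open>J\<close> integrates \<open>G\<close> against the approximating
      polynomial. The exponent is \<open>Suc i\<close> because the weight adds one factor to the
      monomial of degree \<open>i\<close>.\<close>
    define J where "J T = (\<Sum>i\<le>n. a i * integral {0..T} (\<lambda>t. G t * exp (- (real (Suc i) * t))))" for T
    have J: "((\<lambda>t. g (exp (- t)) * G t * exp (- t)) has_integral J T) {0..T}" for T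
    proof -
      have "((\<lambda>t. \<Sum>i\<le>n. a i * (G t * exp (- (real (Suc i) * t)))) has_integral J T) {0..T}"
        unfolding J_def
        by (intro has_integral_sum has_integral_mult_right integrable_integral
          integrable_continuous_interval continuous_intros contG) auto
      moreover have exp_pow: "exp (- t) ^ i * exp (- t) = exp (- (real (Suc i) * t))" for t i
        using exp_of_nat_mult[of "Suc i" "- t"] by (simp add: mult.commute del: of_nat_Suc)
      have "(\<Sum>i\<le>n. a i * (G t * exp (- (real (Suc i) * t)))) = g (exp (- t)) * G t * exp (- t)" for t
        unfolding g_eq exp_pow[symmetric] by (simp add: sum_distrib_left sum_distrib_right mult_ac)
      ultimately show ?thesis by simp
    qed
    have "J \<longlonglongrightarrow> 0" if False using that by simp
    have Jlim: "(J \<longlongrightarrow> (\<Sum>i\<le>n. a i * 0)) at_top"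
      unfolding J_def by (intro tendsto_intros moments)
    \<comment> \<open>Only the limit of \<open>J\<close> is known, so \<open>T\<close> stays fixed
      and \<open>T'\<close> goes to infinity; \<open>I\<close> is monotone because its integrand is
      nonnegative.\<close>
    have "I T \<le> e * M + J T'" if "T' \<ge> T" for T'
    proof -
      have int: "(\<lambda>t. (G t)\<^sup>2 * exp (- t)) integrable_on {0..T}" for T
        by (intro integrable_continuous_interval continuous_intros contG)
      have "I T \<le> I T'"
        unfolding I_def by (rule integral_subset_le) (use that int in auto)
      also have "I T' \<le> e * M * (1 - exp (- T')) + J T'"
      proof (rule has_integral_le)
        show "((\<lambda>t. (G t)\<^sup>2 * exp (- t)) has_integral I T') {0..T'}"
          unfolding I_def using int by (rule integrable_integral)
        have "((\<lambda>t. exp (- t)) has_integral - exp (- T') - - exp (- 0)) {0..T'}"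
          by (rule fundamental_theorem_of_calculus)
             (use that \<open>T \<ge> 0\<close> in \<open>auto intro!: derivative_eq_intros
                simp flip: has_real_derivative_iff_has_vector_derivative\<close>)
        then have "((\<lambda>t. exp (- t)) has_integral 1 - exp (- T')) {0..T'}" by simp
        then show "((\<lambda>t. e * M * exp (- t) + g (exp (- t)) * G t * exp (- t)) has_integral
            e * M * (1 - exp (- T')) + J T') {0..T'}"
          by (intro has_integral_add has_integral_mult_right J)
        fix t assume "t \<in> {0..T'}"
        then have t: "t \<ge> 0" by simp
        have "(G t - g (exp (- t))) * G t \<le> \<bar>G t - g (exp (- t))\<bar> * \<bar>G t\<bar>"
          by (metis abs_ge_self abs_mult)
        also have "\<dots> \<le> e * M"
          using g(2)[of "exp (- t)"] GM[OF t] t \<open>e > 0\<close>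
          by (intro mult_mono) (auto simp: phi_exp)
        finally have "(G t)\<^sup>2 \<le> e * M + g (exp (- t)) * G t"
          by (simp add: left_diff_distrib power2_eq_square)
        then have "(G t)\<^sup>2 * exp (- t) \<le> (e * M + g (exp (- t)) * G t) * exp (- t)"
          by (intro mult_right_mono) auto
        then show "(G t)\<^sup>2 * exp (- t) \<le> e * M * exp (- t) + g (exp (- t)) * G t * exp (- t)"
          by (simp add: distrib_right)
      qed
      also have "\<dots> \<le> e * M * 1 + J T'"
        using \<open>e > 0\<close> \<open>M \<ge> 0\<close> by (intro add_right_mono mult_left_mono) auto
      finally show ?thesis by simp
    qed
    then have "\<forall>\<^sub>F T' in at_top. I T \<le> e * M + J T'"
      by (intro eventually_mono[OF eventually_ge_at_top[of T]]) simp
    moreover have "((\<lambda>T'. e * M + J T') \<longlongrightarrow> e * M + (\<Sum>i\<le>n. a i * 0)) at_top"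
      by (intro tendsto_intros Jlim)
    ultimately have "I T \<le> e * M + (\<Sum>i\<le>n. a i * 0)"
      by (intro tendsto_lowerbound) auto
    then show ?thesis by simp
  qed
  \<comment> \<open>The endpoint \<open>t + 1\<close> keeps the interval nondegenerate for
    \<open>t = 0\<close>, and dividing by \<open>M + 1\<close> below covers
    \<open>M = 0\<close>.\<close>
  have "I (t + 1) \<le> e" if "e > 0" for e
  proof -
    have "I (t + 1) \<le> e / (M + 1) * M"
      using I_le[of "t + 1" "e / (M + 1)"] that \<open>M \<ge> 0\<close> \<open>t \<ge> 0\<close> by simp
    also have "\<dots> \<le> e" using that \<open>M \<ge> 0\<close> by (simp add: field_simps)
    finally show ?thesis .
  qed
  then have "I (t + 1) \<le> 0" by (rule field_le_epsilon) simp
  moreover have "I (t + 1) \<ge> 0"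
    unfolding I_def by (rule integral_nonneg)
      (auto intro!: integrable_continuous_interval continuous_intros contG)
  ultimately have "integral {0..t+1} (\<lambda>t. (G t)\<^sup>2 * exp (- t)) = 0"
    by (simp add: I_def)
  moreover have "continuous_on {0..t+1} (\<lambda>t. (G t)\<^sup>2 * exp (- t))"
    by (intro continuous_intros contG)
  ultimately have "(G t)\<^sup>2 * exp (- t) = 0"
    using \<open>t \<ge> 0\<close> by (subst (asm) integral_eq_0_iff) auto
  then show ?thesis by simp
qed

text \<open>The case \<open>k = 0\<close> says that the primitive \<open>G\<close> tends to 0, and
  integration by parts gives its moments for every \<open>k\<close>, including \<open>k = 0\<close>
  through \<open>Suc k\<close>. Hence \<open>G\<close> vanishes, and so does its derivative
  \<open>q\<close>.\<close>

lemma laplace_zero_imp_zero_real: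
  fixes q :: "real \<Rightarrow> real"
  assumes cont: "continuous_on {0..} q"
    and int: "\<And>k. ((\<lambda>t. q t * exp (- (real k * t))) has_integral 0) {0..}"
    and "t \<ge> 0"
  shows "q t = 0"
proof -
  define G where "G t = integral {0..t} q" for t
  have dG: "(G has_vector_derivative q t) (at t within {0..T})" if "t \<in> {0..T}" for t T
    unfolding G_def
    using that by (intro integral_has_vector_derivative continuous_on_subset[OF cont]) auto
  have "continuous_on {0..} G"
    unfolding continuous_on_def
  proof
    fix x :: real assume x: "x \<in> {0..}"
    have "(G \<longlongrightarrow> G x) (at x within {0..x+1})"
      using has_vector_derivative_continuous[OF dG[of x "x + 1"]] x
      by (simp add: continuous_within)
    moreover have "at x within {0..} = at x within {0..x+1}"
      by (intro at_within_nhd[of x "{..<x+1}"]) auto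
    ultimately show "(G \<longlongrightarrow> G x) (at x within {0..})" by simp
  qed
  moreover have lim: "(G \<longlongrightarrow> 0) at_top"
    using has_integral_atLeast_0D[OF int[of 0]] by (simp add: G_def[abs_def])
  moreover have "((\<lambda>T. integral {0..T} (\<lambda>t. G t * exp (- (real (Suc k) * t)))) \<longlongrightarrow> 0) at_top" for k
    unfolding G_def
    by (rule integral_transform_tendsto_0[OF cont int]) (use lim in \<open>simp_all add: G_def[abs_def]\<close>)
  ultimately have "G x = 0" if "x \<ge> 0" for x
    using vanishing_moments_imp_zero that by blast
  then have "(G has_vector_derivative 0) (at t within {0..t+1})"
    using \<open>t \<ge> 0\<close> by (intro has_vector_derivative_transform[OF _ _ has_vector_derivative_const]) auto
  moreover have "(G has_vector_derivative q t) (at t within {0..t+1})"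
    using \<open>t \<ge> 0\<close> by (intro dG) auto
  ultimately show ?thesis
    using \<open>t \<ge> 0\<close> vector_derivative_unique_within_closed_interval[of 0 "t + 1" t G "q t" 0] by auto
qed

text \<open>Lerch's theorem. Weighting the difference by \<open>exp (- c t)\<close> turns its
  transform at the points \<open>c + k\<close> of the common half-plane into integer moments. These
  weights are real, so real and imaginary parts separate.\<close>

lemma has_laplace_unique:
  assumes f: "continuous_on {0..} f" and g: "continuous_on {0..} g"
    and Lf: "\<forall>\<^sub>F s in far_right. has_laplace f (L s) s"
    and Lg: "\<forall>\<^sub>F s in far_right. has_laplace g (L s) s"
    and "t \<ge> 0"
  shows "f t = g t"
proof -
  from Lf Lg have "\<forall>\<^sub>F s in far_right. has_laplace f (L s) s \<and> has_laplace g (L s) s"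
    by eventually_elim simp
  then obtain b where b: "\<And>s. Re s > b \<Longrightarrow> has_laplace f (L s) s \<and> has_laplace g (L s) s"
    by (auto simp: eventually_far_right)
  define c where "c = b + 1"
  define q where "q t = (f t - g t) * exp (- (of_real c * of_real t))" for t
  have cont: "continuous_on {0..} q"
    unfolding q_def by (intro continuous_intros f g)
  have int: "((\<lambda>t. q t * of_real (exp (- (real k * t)))) has_integral 0) {0..}" for k
  proof -
    let ?s = "complex_of_real (c + real k)"
    have "((\<lambda>t. f t * exp (- (?s * of_real t)) - g t * exp (- (?s * of_real t))) has_integral
        L ?s - L ?s) {0..}"
      using b[of ?s] unfolding has_laplace_def by (intro has_integral_diff) (auto simp: c_def)
    moreover have "exp (- (?s * of_real t)) =
        exp (- (of_real c * of_real t)) * of_real (exp (- (real k * t)))" for t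
      unfolding exp_of_real[symmetric] exp_add[symmetric] by (simp add: distrib_right)
    then have "f t * exp (- (?s * of_real t)) - g t * exp (- (?s * of_real t)) =
        q t * of_real (exp (- (real k * t)))" for t
      by (simp only: q_def left_diff_distrib mult.assoc)
    ultimately show ?thesis by simp
  qed
  have "((\<lambda>t. Re (q t) * exp (- (real k * t))) has_integral 0) {0..}"
    "((\<lambda>t. Im (q t) * exp (- (real k * t))) has_integral 0) {0..}" for k
    using has_integral_linear[OF int[of k] bounded_linear_Re]
      has_integral_linear[OF int[of k] bounded_linear_Im] by (simp_all add: o_def)
  then have "Re (q t) = 0" "Im (q t) = 0"
    using \<open>t \<ge> 0\<close> by (auto intro!: laplace_zero_imp_zero_real[of "\<lambda>t. Re (q t)"]
      laplace_zero_imp_zero_real[of "\<lambda>t. Im (q t)"] continuous_intros cont)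
  then have "q t = 0" by (simp add: complex_eq_iff)
  then show ?thesis by (simp add: q_def)
qed

section \<open>The transform of the compressed quantum walk\<close>

lemma has_rational_laplace_iff:
  "has_rational_laplace f r \<longleftrightarrow> (\<forall>\<^sub>F s in far_right. has_laplace f (rf_eval r s) s)"
  by (simp add: has_rational_laplace_def eventually_far_right)

lemma laplace_eqI:
  assumes "has_rational_laplace f r"
  shows "laplace f = r"
  unfolding laplace_def
proof (rule the_equality)
  fix r' assume "has_rational_laplace f r'"
  with assms have "\<forall>\<^sub>F s in far_right. has_laplace f (rf_eval r' s) s \<and> has_laplace f (rf_eval r s) s"
    unfolding has_rational_laplace_iff by eventually_elim simp
  then have "\<forall>\<^sub>F s in far_right. rf_eval r' s = rf_eval r s"
    by eventually_elim (auto simp: has_laplace_def intro: has_integral_unique)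
  then show "r' = r" by (rule eventually_rf_eval_eq_imp_eq)
qed fact

text \<open>Lerch's theorem settles nonnegative times and the convention in
  \<open>inv_laplace\<close> settles negative ones.\<close>

lemma inv_laplace_eq:
  assumes cont: "continuous_on {0..} f" and r: "has_rational_laplace f r" and "t \<ge> 0"
  shows "inv_laplace r t = f t"
proof -
  \<comment> \<open>\<open>f\<close> may be nonzero at negative times, so its truncation is the
    function that \<open>inv_laplace\<close> selects.\<close>
  define g where "g t = (if t < 0 then 0 else f t)" for t
  have g: "continuous_on {0..} g \<and> (\<forall>t<0. g t = 0) \<and> has_rational_laplace g r"
  proof (intro conjI)
    show "continuous_on {0..} g"
      by (rule continuous_on_eq[OF cont]) (simp add: g_def)
    have "has_laplace g L s \<longleftrightarrow> has_laplace f L s" for L s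
      unfolding has_laplace_def by (rule has_integral_cong) (simp add: g_def)
    then show "has_rational_laplace g r"
      using r by (simp add: has_rational_laplace_def)
  qed (simp add: g_def)
  have "inv_laplace r = g"
    unfolding inv_laplace_def
  proof (rule the_equality, rule g)
    fix h :: "real \<Rightarrow> complex"
    assume h: "continuous_on {0..} h \<and> (\<forall>t<0. h t = 0) \<and> has_rational_laplace h r"
    show "h = g"
    proof
      fix t
      show "h t = g t"
      proof (cases "t < 0")
        case False
        with h r cont have "h t = f t"
          by (intro has_laplace_unique[of h f "rf_eval r"]) (auto simp: has_rational_laplace_iff)
        with False show ?thesis by (simp add: g_def)
      qed (use h in \<open>simp add: g_def\<close>)
    qed
  qed
  with \<open>t \<ge> 0\<close> show ?thesis by (simp add: g_def)
qed

section \<open>Linearity of the transform\<close>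

lemma has_laplace_cmul: "has_laplace f L s \<Longrightarrow> has_laplace (\<lambda>t. c * f t) (c * L) s"
  unfolding has_laplace_def mult.assoc by (rule has_integral_mult_right)

lemma has_laplace_sum:
  "finite I \<Longrightarrow> (\<And>i. i \<in> I \<Longrightarrow> has_laplace (f i) (L i) s) \<Longrightarrow>
     has_laplace (\<lambda>t. \<Sum>i\<in>I. f i t) (\<Sum>i\<in>I. L i) s"
  unfolding has_laplace_def sum_distrib_right by (rule has_integral_sum)

lemma has_laplace_matrix_mult_left:
  fixes F :: "real \<Rightarrow> complex^'n^'m" and L :: "complex^'n^'m"
  assumes "\<And>i j. has_laplace (\<lambda>t. F t $ i $ j) (L $ i $ j) s"
  shows "has_laplace (\<lambda>t. (P ** F t) $ i $ j) ((P ** L) $ i $ j) s"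
  unfolding matrix_mult_nth by (intro has_laplace_sum has_laplace_cmul assms) auto

lemma has_laplace_matrix_mult_right:
  fixes F :: "real \<Rightarrow> complex^'n^'m" and L :: "complex^'n^'m"
  assumes "\<And>i j. has_laplace (\<lambda>t. F t $ i $ j) (L $ i $ j) s"
  shows "has_laplace (\<lambda>t. (F t ** P) $ i $ j) ((L ** P) $ i $ j) s"
  unfolding matrix_mult_nth mult.commute[of _ "P $ _ $ _"]
  by (intro has_laplace_sum has_laplace_cmul assms) auto

text \<open>Far to the right the evaluated rational resolvent is a left inverse of
  \<open>mat s - B\<close>, hence the transform of the exponential; linearity carries this through
  the multiplications by constant matrices.\<close>

lemma has_rational_laplace_compressed_exp:
  fixes B :: "complex^'n^'n" and S :: "complex^'m^'n"
  shows "has_rational_laplace (\<lambda>t. (conj_transpose S ** matrix_exp (of_real t *\<^sub>m B) ** S) $ i $ j)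
     (compressed_resolvent S B $ i $ j)"
  unfolding has_rational_laplace_iff
proof -
  define R where "R = matrix_inv (mat rf_var - rf_matrix B)"
  have R: "R ** (mat rf_var - rf_matrix B) = mat 1"
    unfolding R_def by (intro matrix_inv_left invertible_char_matrix)
  have "\<forall>\<^sub>F s in far_right. Re s > entry_norm B"
    unfolding eventually_far_right by blast
  then show "\<forall>\<^sub>F s in far_right. has_laplace
      (\<lambda>t. (conj_transpose S ** matrix_exp (of_real t *\<^sub>m B) ** S) $ i $ j)
      (rf_eval (compressed_resolvent S B $ i $ j) s) s"
    using eventually_rf_eval_matrix_mult[of R "mat rf_var - rf_matrix B"]
      eventually_rf_eval_char_matrix[of B]
      eventually_rf_eval_matrix_mult[of "rf_matrix (conj_transpose S)" R]
      eventually_rf_eval_matrix_mult[of "rf_matrix (conj_transpose S) ** R" "rf_matrix S"]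
  proof eventually_elim
    case (elim s)
    define W where "W = map_matrix (\<lambda>r. rf_eval r s) R"
    have "map_matrix (\<lambda>r. rf_eval r s) (mat 1 :: ratfun^'n^'n) = mat 1"
      using rf_eval_const[of 1 s] by (simp add: vec_eq_iff mat_def)
    then have "W ** (mat s - B) = mat 1"
      using elim(2) unfolding elim(3) R by (simp add: W_def)
    then have "has_laplace (\<lambda>t. matrix_exp (of_real t *\<^sub>m B) $ i $ j) (W $ i $ j) s" for i j
      using elim(1) by (rule has_laplace_matrix_exp)
    then have "has_laplace (\<lambda>t. (conj_transpose S ** matrix_exp (of_real t *\<^sub>m B) ** S) $ i $ j)
        ((conj_transpose S ** W ** S) $ i $ j) s"
      by (intro has_laplace_matrix_mult_left has_laplace_matrix_mult_right)
    moreover have "map_matrix (\<lambda>r. rf_eval r s) (compressed_resolvent S B) = conj_transpose S ** W ** S"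
      using elim(4,5) by (simp add: compressed_resolvent_def W_def rf_eval_rf_matrix flip: R_def)
    ultimately show ?case by (metis nth_map_matrix)
  qed
qed

lemma continuous_on_compressed_exp:
  "continuous_on X (\<lambda>t. (P ** matrix_exp (of_real t *\<^sub>m B) ** Q) $ i $ j)"
proof -
  have *: "continuous_on X (\<lambda>t. matrix_exp (complex_of_real t *\<^sub>m B) $ i $ j)" for i j
    by (rule continuous_on_compose2[OF _ continuous_on_of_real[OF continuous_on_id], of UNIV])
       (auto intro!: continuous_at_imp_continuous_on DERIV_isCont matrix_exp_has_field_derivative)
  show ?thesis
    unfolding matrix_mult_nth
    by (intro continuous_on_sum continuous_on_mult continuous_on_const *)
qed

theorem theorem4p1:
  fixes A :: "complex^'n^'n" and S :: "complex^'m^'n"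
  assumes "orthonormal_columns S"
  shows "(\<forall>t\<ge>0. conj_transpose S ** quantum_walk t A ** S =
            inv_laplace_matrix
              (matrix_inv (mat rf_var +
                 rf_const \<i> *\<^sub>m isospectral_reduction_at (rf_const \<i> * rf_var) S A)) t)
       \<and> isospectral_reduction S A =
            mat rf_var - rf_const \<i> *\<^sub>m
              matrix_inv (laplace_matrix (rf_const (- \<i>) * rf_var)
                (\<lambda>t. conj_transpose S ** quantum_walk t A ** S))"
proof -
  define B where "B = (- \<i>) *\<^sub>m A"
  have U: "quantum_walk t A = matrix_exp (of_real t *\<^sub>m B)" for t
    by (simp add: quantum_walk_def B_def mat_scale_mat_scale mult.commute)
  have inv_i: "inverse \<i> = - \<i>" "inverse (- \<i>) = \<i>" by simp_all
  have ii: "rf_const \<i> * rf_const \<i> = -1"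
    by (simp flip: rf_const_simps(6))
  let ?K = "compressed_resolvent S"
  have K_inv: "?K M ** matrix_inv (?K M) = mat 1" "matrix_inv (?K M) ** ?K M = mat 1" for M
    using assms by (simp_all add: matrix_inv_right matrix_inv_left invertible_compressed_resolvent)

  define \<sigma> where "\<sigma> r = rf_subst r (rf_const \<i> * rf_var)" for r
  have x: "rf_const \<i> * rf_var = to_fract [:0, \<i>:]" and deg: "degree [:0, \<i>:] > 0"
    by (simp_all add: rf_const_def rf_var_def flip: to_fract_mult)
  \<comment> \<open>The scaling rule with \<open>c = \<i>\<close>, where
    \<open>inverse \<i> *\<^sub>m A\<close> is \<open>B\<close>.\<close>
  have "map_matrix \<sigma> (?K A) = (- rf_const \<i>) *\<^sub>m ?K B"
    using rf_subst_compressed_resolvent[of \<i> S A] by (simp add: \<sigma>_def[abs_def] B_def)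
  moreover have "map_matrix \<sigma> (?K A) ** map_matrix \<sigma> (matrix_inv (?K A)) = mat 1"
    unfolding \<sigma>_def[abs_def] x map_matrix_rf_subst_mult[OF deg, symmetric] K_inv
      map_matrix_rf_subst_mat[OF deg] using rf_subst_const[OF deg, of 1] by simp
  ultimately have "?K B ** ((- rf_const \<i>) *\<^sub>m map_matrix \<sigma> (matrix_inv (?K A))) = mat 1"
    by (simp add: mat_scale_mult_left mat_scale_mult_right)
  then have "matrix_inv (?K B) = (- rf_const \<i>) *\<^sub>m map_matrix \<sigma> (matrix_inv (?K A))"
    by (rule matrix_inv_eqI)
  moreover have "map_matrix \<sigma> (isospectral_reduction S A) =
      mat (rf_const \<i> * rf_var) - map_matrix \<sigma> (matrix_inv (?K A))"
    unfolding isospectral_reduction_def compressed_resolvent_def[symmetric] \<sigma>_def[abs_def] x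
    by (simp only: map_matrix_rf_subst_diff[OF deg] map_matrix_rf_subst_mat[OF deg] rf_subst_var[OF deg])
  \<comment> \<open>The scalar part of the reduction at \<open>\<i> s\<close> is
    \<open>\<i> s I\<close>; multiplied by \<open>\<i>\<close> it cancels \<open>s I\<close>, and
    the rest is the inverse just computed.\<close>
  ultimately have "mat rf_var + rf_const \<i> *\<^sub>m isospectral_reduction_at (rf_const \<i> * rf_var) S A =
      matrix_inv (?K B)"
    unfolding isospectral_reduction_at_def \<sigma>_def[abs_def, symmetric]
    by (simp add: vec_eq_iff mat_def right_diff_distrib ii flip: mult.assoc)
  then have G: "matrix_inv (mat rf_var + rf_const \<i> *\<^sub>m
      isospectral_reduction_at (rf_const \<i> * rf_var) S A) = ?K B"
    using K_inv by (simp add: matrix_inv_eqI)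
  have walk: "conj_transpose S ** quantum_walk t A ** S = inv_laplace_matrix (?K B) t" if "t \<ge> 0" for t
    unfolding vec_eq_iff inv_laplace_matrix_def U
    by (simp add: inv_laplace_eq[OF continuous_on_compressed_exp has_rational_laplace_compressed_exp that])

  have "laplace_matrix (rf_const (- \<i>) * rf_var) (\<lambda>t. conj_transpose S ** quantum_walk t A ** S) =
      map_matrix (\<lambda>r. rf_subst r (rf_const (- \<i>) * rf_var)) (?K B)"
    by (simp add: vec_eq_iff laplace_matrix_def U laplace_eqI[OF has_rational_laplace_compressed_exp]
        del: rf_const_simps)
  \<comment> \<open>The scaling rule with \<open>c = - \<i>\<close> undoes the passage from
    \<open>A\<close> to \<open>B\<close>, since \<open>\<i> *\<^sub>m B\<close> is
    \<open>A\<close>.\<close>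
  also have "\<dots> = rf_const \<i> *\<^sub>m ?K A"
    using rf_subst_compressed_resolvent[of "- \<i>" S B]
    by (simp add: B_def mat_scale_mat_scale del: rf_const_simps)
  finally have L: "laplace_matrix (rf_const (- \<i>) * rf_var)
      (\<lambda>t. conj_transpose S ** quantum_walk t A ** S) = rf_const \<i> *\<^sub>m ?K A" .
  have "(rf_const \<i> *\<^sub>m ?K A) ** ((- rf_const \<i>) *\<^sub>m matrix_inv (?K A)) = mat 1"
    by (simp add: mat_scale_mult_left mat_scale_mult_right K_inv mat_scale_mat_scale ii)
  then have "matrix_inv (rf_const \<i> *\<^sub>m ?K A) = (- rf_const \<i>) *\<^sub>m matrix_inv (?K A)"
    by (rule matrix_inv_eqI)
  then have R: "isospectral_reduction S A = mat rf_var - rf_const \<i> *\<^sub>m matrix_inv (rf_const \<i> *\<^sub>m ?K A)"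
    by (simp add: isospectral_reduction_def compressed_resolvent_def mat_scale_mat_scale ii)
  show ?thesis
    unfolding G L using walk R by blast
qed

end
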